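(* Let $C=(\mathrm{evs},\mathrm{sb},\mathrm{asw},\mathrm{rbf},\mathrm{tot})$ be a well-formed (mixed-size) JavaScript candidate execution with no partial overlaps (any two non-Init events have equal or disjoint ranges) and no tearing (the relation $\mathrm{rf}^{-1}$ is functional, i.e. each event reads from at most one event). Then $C$ is valid in the revised mixed-size JavaScript model if and only if its uni-size reduction is valid in the uni-size JavaScript model.
   Context: **Events.** An event $E$ has a mode $E.\mathrm{ord}\in\{\mathrm{Unordered},\mathrm{SeqCst},\mathrm{Init}\}$, a natural number $E.\mathrm{index}$, byte lists $E.\mathrm{reads}$, $E.\mathrm{writes}$, and a boolean $E.\mathrm{tearfree}$ (all accesses are to one shared buffer). $\mathrm{range}_r(E)=[E.\mathrm{index},E.\mathrm{index}+|E.\mathrm{reads}|)$, $\mathrm{range}_w(E)=[E.\mathrm{index},E.\mathrm{index}+|E.\mathrm{writes}|)$, $\mathrm{range}(E)=\mathrm{range}_r(E)\cup\mathrm{range}_w(E)$; $\mathrm{overlap}(A,B)$ means $\mathrm{range}(A)\cap\mathrm{range}(B)\neq\emptyset$. A write is an event with nonempty $\mathrm{writes}$. **Well-formedness.** (i) Every event has $\mathrm{reads}$ or $\mathrm{writes}$ nonempty; if both are (a read-modify-write) they have equal length and the mode is SeqCst. (ii) There is exactly one Init event; it has empty $\mathrm{reads}$, its range contains the range of every event, and it is unrelated by $\mathrm{sb}$ and $\mathrm{asw}$. (iii) $\mathrm{sb}$ is the disjoint union of strict total orders, one on the (non-Init) events of each thread; $\mathrm{asw}$ is a binary relation on $\mathrm{evs}$.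 (iv) $\mathrm{rbf}$ is a set of triples $(k,E_w,E_r)$ with $E_w\ne E_r$, $k\in\mathrm{range}_w(E_w)\cap\mathrm{range}_r(E_r)$ and equal byte values at $k$; every $E_r$ and $k\in\mathrm{range}_r(E_r)$ has exactly one such $E_w$. (v) $\mathrm{tot}$ is a strict total order on $\mathrm{evs}$. **Revised mixed-size model.** $A\ \mathrm{rf}\ B$ iff $\exists k.\ (k,A,B)\in\mathrm{rbf}$. $\mathrm{sw}=\{(A,B): A\ \mathrm{rf}\ B,\ \mathrm{range}_w(A)=\mathrm{range}_r(B),\ A.\mathrm{ord}=B.\mathrm{ord}=\mathrm{SeqCst}\}\cup\mathrm{asw}$. $\mathrm{hb}=(\mathrm{sb}\cup\mathrm{sw}\cup\{(A,B): A.\mathrm{ord}=\mathrm{Init},\ B.\mathrm{ord}\neq\mathrm{Init},\ \mathrm{overlap}(A,B)\})^+$. Valid means: (HB1) $\mathrm{hb}\subseteq\mathrm{tot}$. (HB2) If $E_w\ \mathrm{rf}\ E_r$ then not $E_r\ \mathrm{hb}\ E_w$. (HB3) For $(k,E_w,E_r)\in\mathrm{rbf}$ there is no $E'_w$ with $E_w\ \mathrm{hb}\ E'_w$, $E'_w\ \mathrm{hb}\ E_r$ and $k\in\mathrm{range}_w(E'_w)$. (Tear-Free Reads) For every $E_r$ with $E_r.\mathrm{tearfree}$ there is at most one $E_w$ with $E_w\ \mathrm{rf}\ E_r$, $E_w.\mathrm{tearfree}$ and $\mathrm{range}_w(E_w)=\mathrm{range}_r(E_r)$. (SC Atomics) If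 $E_w\ \mathrm{rf}\ E_r$ and $E_w\ \mathrm{hb}\ E_r$, there is no write $E'_w$ with $E'_w.\mathrm{ord}=\mathrm{SeqCst}$, $E_w\ \mathrm{tot}\ E'_w$, $E'_w\ \mathrm{tot}\ E_r$ and at least one of: (a) $\mathrm{range}_w(E'_w)=\mathrm{range}_r(E_r)$ and $E_w\ \mathrm{sw}\ E_r$; (b) $\mathrm{range}_w(E_w)=\mathrm{range}_w(E'_w)$, $E_w.\mathrm{ord}=\mathrm{SeqCst}$ and $E'_w\ \mathrm{hb}\ E_r$; (c) $\mathrm{range}_w(E'_w)=\mathrm{range}_r(E_r)$, $E_w\ \mathrm{hb}\ E'_w$ and $E_r.\mathrm{ord}=\mathrm{SeqCst}$. **Uni-size reduction and uni-size model.** For $C$ with no partial overlaps, the distinct (pairwise disjoint) ranges of non-Init events are regarded as distinct abstract locations, each non-Init event accessing exactly one location, and the Init event being a write to every location. The reduction keeps $\mathrm{evs}$, modes, $\mathrm{sb}$, $\mathrm{asw}$, $\mathrm{tot}$, and replaces $\mathrm{rbf}$ by $\mathrm{rf}$. In the uni-size model, same-location$(A,B)$ means $A$ and $B$ access a common location; $\mathrm{sw}_u=\{(A,B):A\ \mathrm{rf}\ B,\ A.\mathrm{ord}=B.\mathrm{ord}=\mathrm{SeqCst}\}\cup\mathrm{asw}$; $\mathrm{hb}_u=(\mathrm{sb}\cup\mathrm{sw}_u\cup\{(A,B):A.\mathrm{ord}=\mathrm{Init},\ B.\mathrm{ord}\ne\mathrm{Init},\ \text{same-location}(A,B)\})^+$.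 Uni-size valid means: (HB1) $\mathrm{hb}_u\subseteq\mathrm{tot}$. (HB2) $E_w\ \mathrm{rf}\ E_r$ implies not $E_r\ \mathrm{hb}_u\ E_w$. (HB3) If $E_w\ \mathrm{rf}\ E_r$, there is no write $E'_w$ with $E_w\ \mathrm{hb}_u\ E'_w$, $E'_w\ \mathrm{hb}_u\ E_r$ and same-location$(E'_w,E_r)$. (SC Atomics) If $E_w\ \mathrm{rf}\ E_r$ and $E_w\ \mathrm{hb}_u\ E_r$, there is no write $E'_w$ with $E'_w.\mathrm{ord}=\mathrm{SeqCst}$, $E_w\ \mathrm{tot}\ E'_w$, $E'_w\ \mathrm{tot}\ E_r$ and at least one of: (a) same-location$(E'_w,E_r)$ and $E_w\ \mathrm{sw}_u\ E_r$; (b) same-location$(E_w,E'_w)$, $E_w.\mathrm{ord}=\mathrm{SeqCst}$ and $E'_w\ \mathrm{hb}_u\ E_r$; (c) same-location$(E'_w,E_r)$, $E_w\ \mathrm{hb}_u\ E'_w$ and $E_r.\mathrm{ord}=\mathrm{SeqCst}$. *)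

theory Defs
  imports Main "HOL-Library.Word" "HOL-Library.Disjoint_Sets"
begin

datatype mode = Unordered | SeqCst | Init

text \<open>
  The field \<open>eid\<close> carries the identity of an event: distinct events may agree on
  mode, index, bytes and tear-freedom. Its type is arbitrary.
\<close>

record 'i event =
  eid :: 'i
  ord :: mode
  index :: nat
  reads :: "8 word list"
  writes :: "8 word list"
  tearfree :: bool

definition range_r :: "'i event \<Rightarrow> nat set" where
  "range_r E = {index E ..< index E + length (reads E)}"

definition range_w :: "'i event \<Rightarrow> nat set" where
  "range_w E = {index E ..< index E + length (writes E)}"

definition erange :: "'i event \<Rightarrow> nat set" where
  "erange E = range_r E \<union> range_w E"

definition overlap :: "'i event \<Rightarrow> 'i event \<Rightarrow> bool" where
  "overlap A B \<longleftrightarrow> erange A \<inter> erange B \<noteq> {}"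

definition is_write :: "'i event \<Rightarrow> bool" where
  "is_write E \<longleftrightarrow> writes E \<noteq> []"

record 'e execution =
  evs :: "'e set"
  sb :: "'e rel"
  asw :: "'e rel"
  tot :: "'e rel"

record 'i candidate = "'i event execution" +
  rbf :: "(nat \<times> 'i event \<times> 'i event) set"

definition wf_events :: "'i candidate \<Rightarrow> bool" where
  "wf_events C \<longleftrightarrow>
     (\<forall>E \<in> evs C.
        (reads E \<noteq> [] \<or> writes E \<noteq> []) \<and>
        (reads E \<noteq> [] \<and> writes E \<noteq> [] \<longrightarrow>
           length (reads E) = length (writes E) \<and> ord E = SeqCst))"

definition wf_init :: "'i candidate \<Rightarrow> bool" where
  "wf_init C \<longleftrightarrow>
     (\<exists>!I. I \<in> evs C \<and> ord I = Init) \<and>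
     (\<forall>I \<in> evs C. ord I = Init \<longrightarrow>
        reads I = [] \<and>
        (\<forall>E \<in> evs C. erange E \<subseteq> erange I) \<and>
        (\<forall>E. (I, E) \<notin> sb C \<union> asw C \<and> (E, I) \<notin> sb C \<union> asw C))"

text \<open>
  The threads are the blocks of a partition of the non-Init events. Since
  \<open>strict_linear_order_on T r\<close> does not bound the field of \<open>r\<close>, the restriction to
  \<open>T\<close> and the union equation are needed to exclude edges across threads.
\<close>

definition wf_sb :: "'i candidate \<Rightarrow> bool" where
  "wf_sb C \<longleftrightarrow>
     (\<exists>threads. partition_on {E \<in> evs C. ord E \<noteq> Init} threads \<and>
        sb C = (\<Union>T \<in> threads. Restr (sb C) T) \<and>
        (\<forall>T \<in> threads. strict_linear_order_on T (Restr (sb C) T)))"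

definition wf_asw :: "'i candidate \<Rightarrow> bool" where
  "wf_asw C \<longleftrightarrow> asw C \<subseteq> evs C \<times> evs C"

definition wf_rbf :: "'i candidate \<Rightarrow> bool" where
  "wf_rbf C \<longleftrightarrow>
     (\<forall>(k, Ew, Er) \<in> rbf C.
        Ew \<in> evs C \<and> Er \<in> evs C \<and> Ew \<noteq> Er \<and>
        k \<in> range_w Ew \<inter> range_r Er \<and>
        writes Ew ! (k - index Ew) = reads Er ! (k - index Er)) \<and>
     (\<forall>Er \<in> evs C. \<forall>k \<in> range_r Er. \<exists>!Ew. (k, Ew, Er) \<in> rbf C)"

definition wf_tot :: "'i candidate \<Rightarrow> bool" where
  "wf_tot C \<longleftrightarrow> tot C \<subseteq> evs C \<times> evs C \<and> strict_linear_order_on (evs C) (tot C)"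

definition well_formed :: "'i candidate \<Rightarrow> bool" where
  "well_formed C \<longleftrightarrow>
     wf_events C \<and> wf_init C \<and> wf_sb C \<and> wf_asw C \<and> wf_rbf C \<and> wf_tot C"

definition rf :: "'i candidate \<Rightarrow> 'i event rel" where
  "rf C = {(A, B). \<exists>k. (k, A, B) \<in> rbf C}"

definition sw :: "'i candidate \<Rightarrow> 'i event rel" where
  "sw C = {(A, B). (A, B) \<in> rf C \<and> range_w A = range_r B \<and>
                   ord A = SeqCst \<and> ord B = SeqCst} \<union> asw C"

definition hb :: "'i candidate \<Rightarrow> 'i event rel" where
  "hb C = (sb C \<union> sw C \<union>
           {(A, B) \<in> evs C \<times> evs C. ord A = Init \<and> ord B \<noteq> Init \<and> overlap A B})\<^sup>+"

definition mixed_HB1 :: "'i candidate \<Rightarrow> bool" where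
  "mixed_HB1 C \<longleftrightarrow> hb C \<subseteq> tot C"

definition mixed_HB2 :: "'i candidate \<Rightarrow> bool" where
  "mixed_HB2 C \<longleftrightarrow> (\<forall>(Ew, Er) \<in> rf C. (Er, Ew) \<notin> hb C)"

definition mixed_HB3 :: "'i candidate \<Rightarrow> bool" where
  "mixed_HB3 C \<longleftrightarrow>
     (\<forall>(k, Ew, Er) \<in> rbf C.
        \<not> (\<exists>Ew' \<in> evs C. (Ew, Ew') \<in> hb C \<and> (Ew', Er) \<in> hb C \<and> k \<in> range_w Ew'))"

definition tear_free_reads :: "'i candidate \<Rightarrow> bool" where
  "tear_free_reads C \<longleftrightarrow>
     (\<forall>Er \<in> evs C. tearfree Er \<longrightarrow>
        (\<exists>\<^sub>\<le>\<^sub>1 Ew. (Ew, Er) \<in> rf C \<and> tearfree Ew \<and> range_w Ew = range_r Er))"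

definition mixed_SC_atomics :: "'i candidate \<Rightarrow> bool" where
  "mixed_SC_atomics C \<longleftrightarrow>
     (\<forall>Ew Er. (Ew, Er) \<in> rf C \<and> (Ew, Er) \<in> hb C \<longrightarrow>
        \<not> (\<exists>Ew' \<in> evs C. is_write Ew' \<and> ord Ew' = SeqCst \<and>
             (Ew, Ew') \<in> tot C \<and> (Ew', Er) \<in> tot C \<and>
             (range_w Ew' = range_r Er \<and> (Ew, Er) \<in> sw C \<or>
              range_w Ew = range_w Ew' \<and> ord Ew = SeqCst \<and> (Ew', Er) \<in> hb C \<or>
              range_w Ew' = range_r Er \<and> (Ew, Ew') \<in> hb C \<and> ord Er = SeqCst)))"

definition mixed_valid :: "'i candidate \<Rightarrow> bool" where
  "mixed_valid C \<longleftrightarrow>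
     mixed_HB1 C \<and> mixed_HB2 C \<and> mixed_HB3 C \<and> tear_free_reads C \<and> mixed_SC_atomics C"

text \<open>
  Events and locations are abstract; what the model inspects of an event (mode, locations
  accessed, being a write) is given by functions on events. A set of locations is needed
  because the Init event accesses all of them.
\<close>

record ('e, 'l) uni_execution = "'e execution" +
  uni_ord :: "'e \<Rightarrow> mode"
  uni_locs :: "'e \<Rightarrow> 'l set"
  uni_is_write :: "'e \<Rightarrow> bool"
  uni_rf :: "'e rel"

definition same_location :: "('e, 'l) uni_execution \<Rightarrow> 'e \<Rightarrow> 'e \<Rightarrow> bool" where
  "same_location U A B \<longleftrightarrow> uni_locs U A \<inter> uni_locs U B \<noteq> {}"

definition uni_sw :: "('e, 'l) uni_execution \<Rightarrow> 'e rel" where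
  "uni_sw U = {(A, B). (A, B) \<in> uni_rf U \<and> uni_ord U A = SeqCst \<and> uni_ord U B = SeqCst} \<union> asw U"

definition uni_hb :: "('e, 'l) uni_execution \<Rightarrow> 'e rel" where
  "uni_hb U = (sb U \<union> uni_sw U \<union>
               {(A, B) \<in> evs U \<times> evs U.
                  uni_ord U A = Init \<and> uni_ord U B \<noteq> Init \<and> same_location U A B})\<^sup>+"

definition uni_HB1 :: "('e, 'l) uni_execution \<Rightarrow> bool" where
  "uni_HB1 U \<longleftrightarrow> uni_hb U \<subseteq> tot U"

definition uni_HB2 :: "('e, 'l) uni_execution \<Rightarrow> bool" where
  "uni_HB2 U \<longleftrightarrow> (\<forall>(Ew, Er) \<in> uni_rf U. (Er, Ew) \<notin> uni_hb U)"

definition uni_HB3 :: "('e, 'l) uni_execution \<Rightarrow> bool" where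
  "uni_HB3 U \<longleftrightarrow>
     (\<forall>(Ew, Er) \<in> uni_rf U.
        \<not> (\<exists>Ew' \<in> evs U. uni_is_write U Ew' \<and>
             (Ew, Ew') \<in> uni_hb U \<and> (Ew', Er) \<in> uni_hb U \<and> same_location U Ew' Er))"

definition uni_SC_atomics :: "('e, 'l) uni_execution \<Rightarrow> bool" where
  "uni_SC_atomics U \<longleftrightarrow>
     (\<forall>Ew Er. (Ew, Er) \<in> uni_rf U \<and> (Ew, Er) \<in> uni_hb U \<longrightarrow>
        \<not> (\<exists>Ew' \<in> evs U. uni_is_write U Ew' \<and> uni_ord U Ew' = SeqCst \<and>
             (Ew, Ew') \<in> tot U \<and> (Ew', Er) \<in> tot U \<and>
             (same_location U Ew' Er \<and> (Ew, Er) \<in> uni_sw U \<or>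
              same_location U Ew Ew' \<and> uni_ord U Ew = SeqCst \<and> (Ew', Er) \<in> uni_hb U \<or>
              same_location U Ew' Er \<and> (Ew, Ew') \<in> uni_hb U \<and> uni_ord U Er = SeqCst)))"

definition uni_valid :: "('e, 'l) uni_execution \<Rightarrow> bool" where
  "uni_valid U \<longleftrightarrow> uni_HB1 U \<and> uni_HB2 U \<and> uni_HB3 U \<and> uni_SC_atomics U"

definition no_partial_overlaps :: "'i candidate \<Rightarrow> bool" where
  "no_partial_overlaps C \<longleftrightarrow>
     (\<forall>A \<in> evs C. \<forall>B \<in> evs C. ord A \<noteq> Init \<and> ord B \<noteq> Init \<longrightarrow>
        erange A = erange B \<or> erange A \<inter> erange B = {})"

definition no_tearing :: "'i candidate \<Rightarrow> bool" where
  "no_tearing C \<longleftrightarrow> single_valued ((rf C)\<inverse>)"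

text \<open>
  A location is the range of a non-Init event, used only as a name: a whole byte range is
  one element of the location type \<open>nat set\<close>.
\<close>

definition locations :: "'i candidate \<Rightarrow> nat set set" where
  "locations C = erange ` {E \<in> evs C. ord E \<noteq> Init}"

definition uni_reduction :: "'i candidate \<Rightarrow> ('i event, nat set) uni_execution" where
  "uni_reduction C =
     \<lparr> evs = evs C, sb = sb C, asw = asw C, tot = tot C,
       uni_ord = ord,
       uni_locs = (\<lambda>E. if ord E = Init then locations C else {erange E}),
       uni_is_write = is_write,
       uni_rf = rf C \<rparr>"

end

(* Away from Init, an event that writes has range_w = erange and an event that reads has
   range_r = erange, since a read-modify-write has equally long byte lists. Without partial overlaps,
   sharing one byte therefore means having the same range, i.e. the same abstract location. So the
   two models have the same sw, hence the same hb, and their axioms agree one by one; Tear-Free Reads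
   holds because rf is already functional in the reader. *)

theory Submission
  imports Defs
begin

lemma range_w_eq_erange:
  assumes "wf_events C" "E \<in> evs C" "is_write E"
  shows "range_w E = erange E"
  using assms by (cases "reads E = []") (auto simp: wf_events_def is_write_def range_w_def range_r_def erange_def)

lemma range_r_eq_erange:
  assumes "wf_events C" "E \<in> evs C" "reads E \<noteq> []"
  shows "range_r E = erange E"
  using assms by (cases "writes E = []") (auto simp: wf_events_def range_w_def range_r_def erange_def)

lemma erange_nonempty:
  assumes "wf_events C" "E \<in> evs C"
  shows "erange E \<noteq> {}"
  using assms by (auto simp: wf_events_def range_w_def range_r_def erange_def)

lemma in_range_w_is_write: "k \<in> range_w E \<Longrightarrow> is_write E"
  by (auto simp: range_w_def is_write_def)

lemma rbfD:
  assumes "well_formed C" "(k, A, B) \<in> rbf C"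
  shows "A \<in> evs C" "B \<in> evs C" "k \<in> range_w A" "k \<in> range_r B"
    "is_write A" "reads B \<noteq> []" "ord B \<noteq> Init"
proof -
  have "\<forall>(k, A, B) \<in> rbf C. A \<in> evs C \<and> B \<in> evs C \<and> k \<in> range_w A \<inter> range_r B"
    using assms(1) unfolding well_formed_def wf_rbf_def by fast
  with assms(2) show *: "A \<in> evs C" "B \<in> evs C" "k \<in> range_w A" "k \<in> range_r B"
    by auto
  show "is_write A"
    using *(3) by (rule in_range_w_is_write)
  show **: "reads B \<noteq> []"
    using *(4) by (auto simp: range_r_def)
  \<comment> \<open>A reader cannot be Init, because Init has empty \<open>reads\<close>. So a
    reader accesses exactly one location, and \<open>no_partial_overlaps\<close> speaks about
    it.\<close>
  show "ord B \<noteq> Init"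
    using assms(1) *(2) ** by (auto simp: well_formed_def wf_init_def)
qed

lemma rfD:
  assumes "well_formed C" "(A, B) \<in> rf C"
  shows "A \<in> evs C" "B \<in> evs C" "is_write A" "reads B \<noteq> []" "ord B \<noteq> Init"
  using assms by (auto simp: rf_def dest: rbfD)

lemma uni_reduction_simps [simp]:
  "evs (uni_reduction C) = evs C" "sb (uni_reduction C) = sb C"
  "asw (uni_reduction C) = asw C" "tot (uni_reduction C) = tot C"
  "uni_ord (uni_reduction C) = ord" "uni_is_write (uni_reduction C) = is_write"
  "uni_rf (uni_reduction C) = rf C"
  by (simp_all add: uni_reduction_def)

lemma same_location_non_Init:
  assumes "ord A \<noteq> Init" "ord B \<noteq> Init"
  shows "same_location (uni_reduction C) A B \<longleftrightarrow> erange A = erange B"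
  using assms by (auto simp: same_location_def uni_reduction_def)

lemma same_location_Init:
  assumes "ord A = Init" "B \<in> evs C" "ord B \<noteq> Init"
  shows "same_location (uni_reduction C) A B"
  using assms by (auto simp: same_location_def uni_reduction_def locations_def)

lemma overlap_Init:
  assumes "well_formed C" "A \<in> evs C" "B \<in> evs C" "ord A = Init"
  shows "overlap A B"
proof -
  have "erange B \<subseteq> erange A"
    using assms by (simp add: well_formed_def wf_init_def)
  moreover have "erange B \<noteq> {}"
    using assms by (auto simp: well_formed_def dest: erange_nonempty)
  ultimately show ?thesis
    by (auto simp: overlap_def)
qed

lemma uni_sw_reduction:
  assumes wf: "well_formed C" and npo: "no_partial_overlaps C"
  shows "uni_sw (uni_reduction C) = sw C"
proof -
  have wfe: "wf_events C"
    using wf by (simp add: well_formed_def)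
  \<comment> \<open>The range condition in \<open>sw\<close> is automatic: the byte \<open>k\<close>
    witnessing \<open>rf\<close> lies in both ranges, so they are not disjoint, and the mode SeqCst
    rules out Init.\<close>
  have "range_w A = range_r B"
    if rf: "(A, B) \<in> rf C" and ord: "ord A = SeqCst" "ord B = SeqCst" for A B
  proof -
    from rf obtain k where k: "(k, A, B) \<in> rbf C"
      by (auto simp: rf_def)
    note D = rbfD[OF wf k]
    have "k \<in> erange A \<inter> erange B"
      using D by (auto simp: erange_def)
    then have "erange A = erange B"
      using npo D ord unfolding no_partial_overlaps_def by (metis empty_iff mode.distinct(5))
    then show ?thesis
      using range_w_eq_erange[OF wfe] range_r_eq_erange[OF wfe] D by simp
  qed
  then show ?thesis
    by (auto simp: uni_sw_def sw_def)
qed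

lemma uni_hb_reduction:
  assumes "well_formed C" "no_partial_overlaps C"
  shows "uni_hb (uni_reduction C) = hb C"
proof -
  \<comment> \<open>For these pairs both side conditions always hold: Init accesses every location,
    and its range contains the nonempty range of \<open>B\<close>.\<close>
  have "{(A, B) \<in> evs C \<times> evs C. ord A = Init \<and> ord B \<noteq> Init \<and> same_location (uni_reduction C) A B}
      = {(A, B) \<in> evs C \<times> evs C. ord A = Init \<and> ord B \<noteq> Init \<and> overlap A B}"
    using same_location_Init overlap_Init[OF assms(1)] by blast
  then show ?thesis
    by (simp add: uni_hb_def hb_def uni_sw_reduction[OF assms])
qed

text \<open>Bridges the bytewise HB3 and the locationwise one. The right-hand side does not depend
  on \<open>k\<close>, so all bytes that \<open>Er\<close> reads from \<open>Ew\<close> impose the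
  same condition.\<close>

lemma in_range_w_iff_same_location:
  assumes wf: "well_formed C" and npo: "no_partial_overlaps C"
    and k: "(k, Ew, Er) \<in> rbf C" and W: "W \<in> evs C"
  shows "k \<in> range_w W \<longleftrightarrow> is_write W \<and> same_location (uni_reduction C) W Er"
proof -
  note D = rbfD[OF wf k]
  have kEr: "k \<in> erange Er"
    using D by (simp add: erange_def)
  show ?thesis
  \<comment> \<open>Init escapes \<open>no_partial_overlaps\<close>, but there both sides are true:
    it reads nothing, so its write range is its whole range and covers \<open>Er\<close>.\<close>
  proof (cases "ord W = Init")
    case True
    then have "reads W = []" "erange Er \<subseteq> erange W"
      using wf W D by (auto simp: well_formed_def wf_init_def)
    then have "k \<in> range_w W"
      using kEr by (auto simp: erange_def range_r_def)
    then show ?thesis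
      using True D same_location_Init in_range_w_is_write by blast
  next
    case False
    \<comment> \<open>As \<open>k\<close> lies in the range of \<open>Er\<close>, containing
      \<open>k\<close> is what separates equal from disjoint.\<close>
    have "erange W = erange Er \<longleftrightarrow> k \<in> erange W"
      using npo W D False kEr unfolding no_partial_overlaps_def by blast
    moreover have "range_w W = erange W" if "is_write W"
      using wf W that unfolding well_formed_def by (metis range_w_eq_erange)
    ultimately show ?thesis
      using False D in_range_w_is_write by (auto simp: same_location_non_Init)
  qed
qed

lemma uni_HB3_reduction:
  assumes "well_formed C" "no_partial_overlaps C"
  shows "uni_HB3 (uni_reduction C) \<longleftrightarrow> mixed_HB3 C"
  using in_range_w_iff_same_location[OF assms]
  unfolding uni_HB3_def mixed_HB3_def uni_hb_reduction[OF assms] uni_reduction_simps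
  by (fastforce simp: rf_def)

lemma tear_free_reads_if_no_tearing:
  assumes "no_tearing C"
  shows "tear_free_reads C"
  using assms by (auto simp: no_tearing_def tear_free_reads_def single_valued_def Uniq_def)

lemma uni_SC_atomics_reduction:
  assumes "well_formed C" "no_partial_overlaps C"
  shows "uni_SC_atomics (uni_reduction C) \<longleftrightarrow> mixed_SC_atomics C"
proof -
  have wfe: "wf_events C"
    using assms(1) by (simp add: well_formed_def)
  \<comment> \<open>The mode of \<open>W\<close> matters: Init shares a location with every reader,
    yet its range may be strictly larger. SC Atomics only asks about SeqCst writes
    \<open>W\<close>.\<close>
  have wr: "same_location (uni_reduction C) W Er \<longleftrightarrow> range_w W = range_r Er"
    if "(Ew, Er) \<in> rf C" "W \<in> evs C" "is_write W" "ord W = SeqCst" for Ew Er W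
    using that rfD[OF assms(1) that(1)]
    by (simp add: same_location_non_Init range_w_eq_erange[OF wfe] range_r_eq_erange[OF wfe])
  \<comment> \<open>Here \<open>Ew\<close> could be Init too; \<open>ord Ew = SeqCst\<close> is
    supplied by the disjunct in which this comparison occurs, and \<open>rf\<close> makes
    \<open>Ew\<close> a write.\<close>
  have ww: "same_location (uni_reduction C) Ew W \<longleftrightarrow> range_w Ew = range_w W"
    if "(Ew, Er) \<in> rf C" "W \<in> evs C" "is_write W" "ord W = SeqCst" "ord Ew = SeqCst" for Ew Er W
    using that rfD[OF assms(1) that(1)]
    by (simp add: same_location_non_Init range_w_eq_erange[OF wfe])
  show ?thesis
    unfolding uni_SC_atomics_def mixed_SC_atomics_def
      uni_hb_reduction[OF assms] uni_sw_reduction[OF assms] uni_reduction_simps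
    using wr ww by blast
qed

theorem mainTheorem5:
  fixes C :: "'i candidate"
  assumes "well_formed C"
    and "no_partial_overlaps C"
    and "no_tearing C"
  shows "mixed_valid C \<longleftrightarrow> uni_valid (uni_reduction C)"
  \<comment> \<open>HB1 and HB2 coincide literally once \<open>hb\<close> does, since the reduction
    keeps \<open>tot\<close> and \<open>rf\<close>.\<close>
  using assms(3)
  by (simp add: mixed_valid_def uni_valid_def mixed_HB1_def uni_HB1_def mixed_HB2_def uni_HB2_def
      uni_hb_reduction[OF assms(1,2)] uni_HB3_reduction[OF assms(1,2)]
      uni_SC_atomics_reduction[OF assms(1,2)] tear_free_reads_if_no_tearing)

end
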